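(* Let $G$ and $M$ be abelian groups. Then the trace map $$\operatorname{Tr}: H^3_{2\text{-ab}}(G, M) \to \operatorname{Quad}(G, M),\qquad \operatorname{Tr}[(h,c)](x) = c(x,x),$$ is an isomorphism of abelian groups.
   Context: All groups are abelian and written additively. A (standard) 3-cocycle on $G$ with values in $M$ (trivial action) is a function $h:G^3\to M$ with $h(g_1,g_2,g_3) + h(g_1,g_2+g_3,g_4) + h(g_2,g_3,g_4) = h(g_1+g_2,g_3,g_4) + h(g_1,g_2,g_3+g_4)$ for all $g_i\in G$; the group of these is $Z^3(G,M)$. For $k:G^2\to M$ put $(\delta k)(g_1,g_2,g_3)=k(g_2,g_3)-k(g_1+g_2,g_3)+k(g_1,g_2+g_3)-k(g_1,g_2)$. A 2-abelian 3-cocycle is a pair $(h,c)$ with $h\in Z^3(G,M)$ and $c:G^2\to M$ a function such that for all $x,y,z\in G$: $h(y,z,x)+c(x,y+z)+h(x,y,z)=c(x,z)+h(y,x,z)+c(x,y)$ and $-h(z,x,y)+c(x+y,z)-h(x,y,z)=c(x,z)-h(x,z,y)+c(y,z)$. They form an abelian group $Z^3_{2\text{-ab}}(G,M)$ under pointwise addition. The 2-abelian coboundaries $B^3_{2\text{-ab}}(G,M)$ are the pairs $(\delta k, c_k)$, $k:G^2\to M$ any function, $c_k(x,y)=k(y,x)-k(x,y)$. Then $H^3_{2\text{-ab}}(G,M)=Z^3_{2\text{-ab}}(G,M)/B^3_{2\text{-ab}}(G,M)$ (this is a model for $H^4(K(G,2),M)$). A quadratic form $q:G\to M$ is a function with $q(-a)=q(a)$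 for all $a$ and such that $b_q(a_1,a_2)=q(a_1+a_2)-q(a_1)-q(a_2)$ is bilinear; $\operatorname{Quad}(G,M)$ is the abelian group of all quadratic forms under pointwise addition. For a 2-abelian 3-cocycle $(h,c)$, the function $x\mapsto c(x,x)$ is a quadratic form depending only on the class of $(h,c)$. *)

theory Defs
  imports "HOL-Algebra.Coset" "HOL-Library.Function_Algebras" "HOL-Library.Product_Plus"
begin

text \<open>
  The groups \<open>G\<close> and \<open>M\<close> are types of class \<^class>\<open>ab_group_add\<close>, and a function \<open>G\<^sup>n \<rightarrow> M\<close> is
  curried. Cocycles, coboundaries, cohomology and quadratic forms are HOL-Algebra groups whose
  operation is the pointwise addition of functions and of pairs of functions.
\<close>

definition cocycle3 ::
  "('g::ab_group_add \<Rightarrow> 'g \<Rightarrow> 'g \<Rightarrow> 'm::ab_group_add) \<Rightarrow> bool" where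
  "cocycle3 h \<longleftrightarrow> (\<forall>g1 g2 g3 g4.
     h g1 g2 g3 + h g1 (g2 + g3) g4 + h g2 g3 g4 = h (g1 + g2) g3 g4 + h g1 g2 (g3 + g4))"

definition coboundary3 ::
  "('g::ab_group_add \<Rightarrow> 'g \<Rightarrow> 'm::ab_group_add) \<Rightarrow> 'g \<Rightarrow> 'g \<Rightarrow> 'g \<Rightarrow> 'm" where
  "coboundary3 k = (\<lambda>g1 g2 g3. k g2 g3 - k (g1 + g2) g3 + k g1 (g2 + g3) - k g1 g2)"

definition two_abelian_cocycle ::
  "('g::ab_group_add \<Rightarrow> 'g \<Rightarrow> 'g \<Rightarrow> 'm::ab_group_add) \<Rightarrow> ('g \<Rightarrow> 'g \<Rightarrow> 'm) \<Rightarrow> bool" where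
  "two_abelian_cocycle h c \<longleftrightarrow> cocycle3 h \<and>
     (\<forall>x y z. h y z x + c x (y + z) + h x y z = c x z + h y x z + c x y) \<and>
     (\<forall>x y z. - h z x y + c (x + y) z - h x y z = c x z - h x z y + c y z)"

type_synonym ('g, 'm) two_ab_cochain = "('g \<Rightarrow> 'g \<Rightarrow> 'g \<Rightarrow> 'm) \<times> ('g \<Rightarrow> 'g \<Rightarrow> 'm)"

definition Z3_2ab :: "('g::ab_group_add, 'm::ab_group_add) two_ab_cochain monoid" where
  "Z3_2ab = \<lparr>carrier = {(h, c). two_abelian_cocycle h c}, mult = (+), one = 0\<rparr>"

definition B3_2ab :: "('g::ab_group_add, 'm::ab_group_add) two_ab_cochain set" where
  "B3_2ab = range (\<lambda>k. (coboundary3 k, \<lambda>x y. k y x - k x y))"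

definition H3_2ab :: "('g::ab_group_add, 'm::ab_group_add) two_ab_cochain set monoid" where
  "H3_2ab = Z3_2ab Mod B3_2ab"

definition polar ::
  "('g::ab_group_add \<Rightarrow> 'm::ab_group_add) \<Rightarrow> 'g \<Rightarrow> 'g \<Rightarrow> 'm" where
  "polar q = (\<lambda>a1 a2. q (a1 + a2) - q a1 - q a2)"

definition biadditive ::
  "('g::ab_group_add \<Rightarrow> 'g \<Rightarrow> 'm::ab_group_add) \<Rightarrow> bool" where
  "biadditive b \<longleftrightarrow>
     (\<forall>x y z. b (x + y) z = b x z + b y z) \<and> (\<forall>x y z. b x (y + z) = b x y + b x z)"

definition quadratic_form :: "('g::ab_group_add \<Rightarrow> 'm::ab_group_add) \<Rightarrow> bool" where
  "quadratic_form q \<longleftrightarrow> (\<forall>a. q (- a) = q a) \<and> biadditive (polar q)"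

definition Quad :: "('g::ab_group_add \<Rightarrow> 'm::ab_group_add) monoid" where
  "Quad = \<lparr>carrier = {q. quadratic_form q}, mult = (+), one = 0\<rparr>"

text \<open>
  The value at a class is the common value of \<open>x \<mapsto> c x x\<close> at all its representatives;
  \<open>trace_map_class\<close> below shows that it is well defined.
\<close>

definition trace_map ::
  "('g::ab_group_add, 'm::ab_group_add) two_ab_cochain set \<Rightarrow> 'g \<Rightarrow> 'm" where
  "trace_map C = the_elem ((\<lambda>(h, c) x. c x x) ` C)"

lemma two_abelian_cocycle_0: "two_abelian_cocycle 0 0"
  by (simp add: two_abelian_cocycle_def cocycle3_def)

lemma two_abelian_cocycle_add:
  assumes "two_abelian_cocycle h c" "two_abelian_cocycle h' c'"
  shows "two_abelian_cocycle (h + h') (c + c')"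
  unfolding two_abelian_cocycle_def cocycle3_def
proof (intro conjI allI, goal_cases)
  case (1 g1 g2 g3 g4)
  have "(h g1 g2 g3 + h g1 (g2 + g3) g4 + h g2 g3 g4) + (h' g1 g2 g3 + h' g1 (g2 + g3) g4 + h' g2 g3 g4)
    = (h (g1 + g2) g3 g4 + h g1 g2 (g3 + g4)) + (h' (g1 + g2) g3 g4 + h' g1 g2 (g3 + g4))"
    using assms by (simp only: two_abelian_cocycle_def cocycle3_def)
  then show ?case by (simp add: algebra_simps)
next
  case (2 x y z)
  have "(h y z x + c x (y + z) + h x y z) + (h' y z x + c' x (y + z) + h' x y z)
    = (c x z + h y x z + c x y) + (c' x z + h' y x z + c' x y)"
    using assms by (simp only: two_abelian_cocycle_def)
  then show ?case by (simp add: algebra_simps)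
next
  case (3 x y z)
  have "(- h z x y + c (x + y) z - h x y z) + (- h' z x y + c' (x + y) z - h' x y z)
    = (c x z - h x z y + c y z) + (c' x z - h' x z y + c' y z)"
    using assms by (simp only: two_abelian_cocycle_def)
  then show ?case by (simp add: algebra_simps)
qed

lemma two_abelian_cocycle_uminus:
  assumes "two_abelian_cocycle h c"
  shows "two_abelian_cocycle (- h) (- c)"
  unfolding two_abelian_cocycle_def cocycle3_def
proof (intro conjI allI, goal_cases)
  case (1 g1 g2 g3 g4)
  have "- (h g1 g2 g3 + h g1 (g2 + g3) g4 + h g2 g3 g4) = - (h (g1 + g2) g3 g4 + h g1 g2 (g3 + g4))"
    using assms by (simp only: two_abelian_cocycle_def cocycle3_def)
  then show ?case by (simp add: algebra_simps)
next
  case (2 x y z)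
  have "- (h y z x + c x (y + z) + h x y z) = - (c x z + h y x z + c x y)"
    using assms by (simp only: two_abelian_cocycle_def)
  then show ?case by (simp add: algebra_simps)
next
  case (3 x y z)
  have "- (- h z x y + c (x + y) z - h x y z) = - (c x z - h x z y + c y z)"
    using assms by (simp only: two_abelian_cocycle_def)
  then show ?case by (simp add: algebra_simps)
qed

lemma two_abelian_cocycle_coboundary:
  "two_abelian_cocycle (coboundary3 k) (\<lambda>x y. k y x - k x y)"
  by (simp add: two_abelian_cocycle_def cocycle3_def coboundary3_def algebra_simps)

lemma comm_group_Z3_2ab:
  "comm_group (Z3_2ab :: ('g::ab_group_add, 'm::ab_group_add) two_ab_cochain monoid)"
proof (rule comm_groupI, goal_cases)
  case (6 p)
  then have "- p \<in> carrier Z3_2ab"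
    by (cases p) (simp add: Z3_2ab_def two_abelian_cocycle_uminus)
  then show ?case
    by (intro bexI[of _ "- p"]) (simp add: Z3_2ab_def)
qed (auto simp: Z3_2ab_def two_abelian_cocycle_0 two_abelian_cocycle_add zero_prod_def add_ac)

lemma subgroup_B3_2ab:
  "subgroup (B3_2ab :: ('g::ab_group_add, 'm::ab_group_add) two_ab_cochain set) Z3_2ab"
proof -
  interpret Z: comm_group "Z3_2ab :: ('g, 'm) two_ab_cochain monoid"
    by (rule comm_group_Z3_2ab)
  let ?d = "\<lambda>k :: 'g \<Rightarrow> 'g \<Rightarrow> 'm. (coboundary3 k, \<lambda>x y. k y x - k x y)"
  have d_add: "?d k + ?d l = ?d (k + l)" for k l
    by (simp add: coboundary3_def fun_eq_iff)
  have d_uminus: "?d (- k) + ?d k = 0" for k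
    by (simp add: coboundary3_def fun_eq_iff zero_prod_def)
  have d_Z: "?d k \<in> carrier Z3_2ab" for k
    by (simp add: Z3_2ab_def two_abelian_cocycle_coboundary)
  have d_B: "?d k \<in> B3_2ab" for k
    unfolding B3_2ab_def by (rule rangeI)
  show ?thesis
  proof (rule Z.subgroupI)
    show "B3_2ab \<subseteq> carrier (Z3_2ab :: ('g, 'm) two_ab_cochain monoid)"
      using d_Z by (auto simp: B3_2ab_def)
    show "(B3_2ab :: ('g, 'm) two_ab_cochain set) \<noteq> {}"
      by (simp add: B3_2ab_def)
    fix a :: "('g, 'm) two_ab_cochain" assume "a \<in> B3_2ab"
    then obtain k where a: "a = ?d k" by (auto simp: B3_2ab_def)
    have "inv\<^bsub>Z3_2ab\<^esub> a = ?d (- k)"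
      unfolding a
    proof (rule Z.inv_equality[OF _ d_Z d_Z])
      show "?d (- k) \<otimes>\<^bsub>Z3_2ab\<^esub> ?d k = \<one>\<^bsub>Z3_2ab\<^esub>"
        using d_uminus[of k] by (simp only: Z3_2ab_def monoid.simps)
    qed
    then show "inv\<^bsub>Z3_2ab\<^esub> a \<in> B3_2ab"
      by (simp only: d_B)
    fix b :: "('g, 'm) two_ab_cochain" assume "b \<in> B3_2ab"
    then obtain l where b: "b = ?d l" by (auto simp: B3_2ab_def)
    have "a \<otimes>\<^bsub>Z3_2ab\<^esub> b = ?d (k + l)"
      unfolding a b d_add[symmetric] by (simp add: Z3_2ab_def)
    then show "a \<otimes>\<^bsub>Z3_2ab\<^esub> b \<in> B3_2ab"
      by (simp only: d_B)
  qed
qed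

lemma comm_group_H3_2ab:
  "comm_group (H3_2ab :: ('g::ab_group_add, 'm::ab_group_add) two_ab_cochain set monoid)"
  unfolding H3_2ab_def
  by (rule comm_group.abelian_FactGroup[OF comm_group_Z3_2ab subgroup_B3_2ab])

lemma comm_group_Quad:
  "comm_group (Quad :: ('g::ab_group_add \<Rightarrow> 'm::ab_group_add) monoid)"
proof -
  have polar_add: "polar (q + r) a b = polar q a b + polar r a b"
    and polar_uminus: "polar (- q) a b = - polar q a b"
    for q r :: "'g \<Rightarrow> 'm" and a b
    by (simp_all add: polar_def)
  show ?thesis
  proof (rule comm_groupI, goal_cases)
    case (1 q r)
    then show ?case
      by (simp add: Quad_def quadratic_form_def biadditive_def polar_add add_ac)
  next
    case (6 q)
    then have "- q \<in> carrier Quad"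
      by (simp add: Quad_def quadratic_form_def biadditive_def polar_uminus)
    then show ?case
      by (intro bexI[of _ "- q"]) (simp add: Quad_def)
  qed (auto simp: Quad_def quadratic_form_def biadditive_def polar_def add_ac)
qed

lemma trace_map_class:
  "trace_map (B3_2ab #>\<^bsub>Z3_2ab\<^esub> (h, c)) = (\<lambda>x. c x x)"
proof -
  have "(\<lambda>(h, c) x. c x x) ` (B3_2ab #>\<^bsub>Z3_2ab\<^esub> (h, c)) = {\<lambda>x. c x x}"
    by (force simp: r_coset_def B3_2ab_def Z3_2ab_def)
  then show ?thesis
    by (simp add: trace_map_def)
qed

end

theory Submission
  imports Defs "HOL-Algebra.Free_Abelian_Groups" "HOL.Modules"
begin

text \<open>
  Write \<open>G = F / R\<close> with \<open>F\<close> free abelian; then \<open>R\<close> is free as well.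

  Injectivity: let \<open>(h, c)\<close> have trace zero, so that \<open>c\<close> is antisymmetric. On an infinite cyclic group
  \<open>(h, c)\<close> is trivial, and trivializations on two summands glue to one on their sum, with the
  interchange isomorphism of the braiding as correction term. Hence the pullback of \<open>(h, c)\<close> to \<open>F\<close> is
  \<open>(\<delta>k, c\<^sub>k)\<close>. On \<open>R\<close> the cochain \<open>k\<close> is a symmetric 2-cocycle, hence a coboundary because \<open>R\<close> is free, and
  after changing \<open>k\<close> by a coboundary it descends to \<open>G\<close>.

  Surjectivity: on \<open>F\<close> a quadratic form is \<open>b(x, x)\<close> for a bilinear \<open>b\<close>, and if it comes from \<open>G\<close> then \<open>b\<close> is
  alternating on \<open>R\<close>, hence \<open>b(r, r') = l(r, r') - l(r', r)\<close> there with \<open>l\<close> bilinear. For a section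
  \<open>s : G \<rightarrow> F\<close> with defect \<open>\<rho>(x, y) = s x + s y - s(x + y)\<close>, the required pair is \<open>c(x, y) = b(s x, s y)\<close> and
  \<open>h(x, y, z) = b(s x, \<rho>(y, z)) + l(\<rho>(x + y, z), \<rho>(x, y)) - l(\<rho>(x, y + z), \<rho>(y, z))\<close>.
\<close>

definition trivializes ::
  "('g::ab_group_add \<Rightarrow> 'g \<Rightarrow> 'm::ab_group_add) \<Rightarrow> ('g \<Rightarrow> 'g \<Rightarrow> 'g \<Rightarrow> 'm) \<Rightarrow> ('g \<Rightarrow> 'g \<Rightarrow> 'm) \<Rightarrow> bool" where
  "trivializes k h c \<longleftrightarrow> h = coboundary3 k \<and> c = (\<lambda>x y. k y x - k x y)"

subsection \<open>The trace is quadratic\<close>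

lemma cocycle3_defect:
  assumes "cocycle3 h"
  shows "h x y z + h x (y + z) w + h y z w - h (x + y) z w - h x y (z + w) = 0"
  using assms by (simp add: cocycle3_def algebra_simps)

lemma hexagon1_defect:
  assumes "two_abelian_cocycle h c"
  shows "c x (y + z) - c x y - c x z + h y z x + h x y z - h y x z = 0"
  using assms by (simp add: two_abelian_cocycle_def algebra_simps)

lemma hexagon2_defect:
  assumes "two_abelian_cocycle h c"
  shows "c (x + y) z - c x z - c y z - h z x y - h x y z + h x z y = 0"
proof -
  have "- h z x y + c (x + y) z - h x y z = c x z - h x z y + c y z"
    using assms by (simp only: two_abelian_cocycle_def)
  then show ?thesis by (simp add: algebra_simps)
qed

lemma two_abelian_cocycle_imp_cocycle3: "two_abelian_cocycle h c \<Longrightarrow> cocycle3 h"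
  by (simp add: two_abelian_cocycle_def)

text \<open>Hexagon 1 splits the second argument of \<open>c (x + y) (x + y)\<close>, hexagon 2 the
  first argument of the two resulting terms; the associators left over form the cocycle identity at
  \<open>(x, y, x, y)\<close>.\<close>

lemma polar_trace:
  assumes "two_abelian_cocycle h c"
  shows "polar (\<lambda>x. c x x) x y = c x y + c y x"
proof -
  note h = cocycle3_defect[OF two_abelian_cocycle_imp_cocycle3[OF assms]]
    and h1 = hexagon1_defect[OF assms] and h2 = hexagon2_defect[OF assms]
  have "polar (\<lambda>x. c x x) x y - (c x y + c y x)
    = (c (x + y) (x + y) - c (x + y) x - c (x + y) y + h x y (x + y) + h (x + y) x y - h x (x + y) y)
    + (c (x + y) x - c x x - c y x - h x x y - h x y x + h x x y)
    + (c (x + y) y - c x y - c y y - h y x y - h x y y + h x y y)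
    + (h x y x + h x (y + x) y + h y x y - h (x + y) x y - h x y (x + y))"
    by (simp add: polar_def algebra_simps)
  also have "\<dots> = 0" by (simp only: h h1 h2 add_0)
  finally show ?thesis by simp
qed

lemma quadratic_form_trace:
  assumes "two_abelian_cocycle h c"
  shows "quadratic_form (\<lambda>x. c x x)"
proof -
  let ?q = "\<lambda>x. c x x"
  note h1 = hexagon1_defect[OF assms] and h2 = hexagon2_defect[OF assms]
  \<comment> \<open>The associator terms of hexagon 1 at \<open>(x, y, z)\<close> and of hexagon 2
    at \<open>(y, z, x)\<close> are opposite, so they cancel in the symmetrized braiding.\<close>
  have additive: "polar ?q x (y + z) = polar ?q x y + polar ?q x z" for x y z
  proof -
    have "polar ?q x (y + z) - (polar ?q x y + polar ?q x z)
      = (c x (y + z) - c x y - c x z + h y z x + h x y z - h y x z)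
      + (c (y + z) x - c y x - c z x - h x y z - h y z x + h y x z)"
      by (simp add: polar_trace[OF assms] algebra_simps)
    also have "\<dots> = 0" by (simp only: h1 h2 add_0)
    finally show ?thesis by simp
  qed
  have sym: "polar ?q x y = polar ?q y x" for x y
    by (simp add: polar_def algebra_simps)
  have biadditive: "biadditive (polar ?q)"
    unfolding biadditive_def by (metis additive sym)
  \<comment> \<open>Both sides of \<open>polar ?q x (- x) = - polar ?q x x\<close> are evaluated:
    the left is \<open>- ?q x - ?q (- x)\<close>, the right \<open>- (?q x + ?q x)\<close>.\<close>
  have "?q (- x) = ?q x" for x
  proof -
    have zero: "polar ?q x 0 = 0" for x
      using additive[of x 0 0] by simp
    have "?q 0 = 0"
      using zero[of 0] by (simp add: polar_def)
    moreover have "polar ?q x (- x) + polar ?q x x = 0"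
      using additive[of x "- x" x] zero by simp
    moreover have "polar ?q x x = ?q x + ?q x"
      by (rule polar_trace[OF assms])
    ultimately show ?thesis
      by (simp add: polar_def algebra_simps)
  qed
  then show ?thesis
    by (simp add: quadratic_form_def biadditive)
qed

subsection \<open>The interchange map of two summands\<close>

text \<open>
  Reading \<open>(h, c)\<close> as the associator and the braiding of a categorical group with objects \<open>G\<close> and
  automorphisms \<open>M\<close>, this is the isomorphism \<open>(a \<otimes> b) \<otimes> (a' \<otimes> b') \<rightarrow> (a \<otimes> a') \<otimes> (b \<otimes> b')\<close>: one term
  for each reassociation and one for moving \<open>b\<close> past \<open>a'\<close>.
\<close>

definition interchange ::
  "('g::ab_group_add \<Rightarrow> 'g \<Rightarrow> 'g \<Rightarrow> 'm::ab_group_add) \<Rightarrow> ('g \<Rightarrow> 'g \<Rightarrow> 'm) \<Rightarrow> 'g \<Rightarrow> 'g \<Rightarrow> 'g \<Rightarrow> 'g \<Rightarrow> 'm" where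
  "interchange h c a b a' b' =
     - h a b (a' + b') + h b a' b' - h a' b b' - c b a' + h a a' (b + b')"

text \<open>The interchange makes the tensor product a monoidal functor in two variables; the
  bracket is its coboundary as a 2-cochain on \<open>G \<times> G\<close>.\<close>

lemma interchange_associator:
  assumes "two_abelian_cocycle h c"
  shows "h (a + b) (a' + b') (a'' + b'') = h a a' a'' + h b b' b''
    + (interchange h c a' b' a'' b'' - interchange h c (a + a') (b + b') a'' b''
       + interchange h c a b (a' + a'') (b' + b'') - interchange h c a b a' b')"
    (is "?l = ?r")
proof -
  note h = cocycle3_defect[OF two_abelian_cocycle_imp_cocycle3[OF assms]]
    and h1 = hexagon1_defect[OF assms] and h2 = hexagon2_defect[OF assms]
  let ?P = "\<lambda>x y z w. h x y z + h x (y + z) w + h y z w - h (x + y) z w - h x y (z + w)"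
    and ?H1 = "\<lambda>x y z. c x (y + z) - c x y - c x z + h y z x + h x y z - h y x z"
    and ?H2 = "\<lambda>x y z. c (x + y) z - c x z - c y z - h z x y - h x y z + h x z y"
  \<comment> \<open>These are the pentagons and hexagons that fill the coherence diagram; the two
    hexagons split \<open>c b (a' + a'')\<close> and \<open>c (b + b') a''\<close>, which come from
    the interchanges of sums.\<close>
  have "?l - ?r =
      ?H1 b a' a''
      + ?P a' b (b' + a'') b''
      + ?P b a' b' (a'' + b'')
      + ?P a' b a'' b'
      + ?P (a' + b) a'' b' b''
      + ?P a a' (b' + b) (a'' + b'')
      - ?P a' (b + a'') b' b''
      - ?P a' b b' (a'' + b'')
      - ?P b a' a'' (b' + b'')
      - ?P a'' b b' b''
      - ?P a b (a' + b') (a'' + b'')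
      - ?H2 b b' a''
      - ?P a' a'' b (b' + b'')
      - ?P b b' a'' b''
      - ?P a a' a'' (b' + b + b'')"
    by (simp add: interchange_def algebra_simps)
  also have "\<dots> = 0" by (simp only: h h1 h2 add_0 diff_0_right)
  finally show ?thesis by simp
qed

text \<open>Splitting both arguments on the left produces the cross terms
  \<open>c a b' + c b a'\<close>, while the interchanges supply \<open>c b a' - c b' a\<close>; the
  vanishing double braiding of \<open>a\<close> and \<open>b'\<close> reconciles them.\<close>

lemma interchange_braiding:
  assumes "two_abelian_cocycle h c" and "c a b' + c b' a = 0"
  shows "c (a + b) (a' + b') = c a a' + c b b'
    + (interchange h c a' b' a b - interchange h c a b a' b')"
    (is "?l = ?r")
proof -
  note h = cocycle3_defect[OF two_abelian_cocycle_imp_cocycle3[OF assms(1)]]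
    and h1 = hexagon1_defect[OF assms(1)] and h2 = hexagon2_defect[OF assms(1)]
  let ?P = "\<lambda>x y z w. h x y z + h x (y + z) w + h y z w - h (x + y) z w - h x y (z + w)"
    and ?H1 = "\<lambda>x y z. c x (y + z) - c x y - c x z + h y z x + h x y z - h y x z"
    and ?H2 = "\<lambda>x y z. c (x + y) z - c x z - c y z - h z x y - h x y z + h x z y"
  have "?l - ?r = ?H2 a b (a' + b') + ?H1 a a' b' + ?H1 b a' b'
      - ?P a' b' a b + ?P a' a b' b - ?P a a' b' b + (c a b' + c b' a)"
    by (simp add: interchange_def algebra_simps)
  also have "\<dots> = 0" by (simp only: h h1 h2 assms(2) add_0 diff_0_right)
  finally show ?thesis by simp
qed

subsection \<open>Normalization and infinite cyclic groups\<close>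

definition normalized ::
  "('g::ab_group_add \<Rightarrow> 'g \<Rightarrow> 'g \<Rightarrow> 'm::ab_group_add) \<Rightarrow> ('g \<Rightarrow> 'g \<Rightarrow> 'm) \<Rightarrow> bool" where
  "normalized h c \<longleftrightarrow> (\<forall>x y. h 0 x y = 0 \<and> h x 0 y = 0 \<and> h x y 0 = 0 \<and> c x 0 = 0 \<and> c 0 x = 0)"

lemma two_abelian_cocycle_diff_coboundary:
  assumes "two_abelian_cocycle h c"
  shows "two_abelian_cocycle (h - coboundary3 k) (c - (\<lambda>x y. k y x - k x y))"
  using two_abelian_cocycle_add[OF assms
      two_abelian_cocycle_uminus[OF two_abelian_cocycle_coboundary[of k]]]
  by simp

lemma trivializes_add:
  assumes "trivializes k h c" "trivializes k' h' c'"
  shows "trivializes (k + k') (h + h') (c + c')"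
  using assms by (simp add: trivializes_def coboundary3_def fun_eq_iff)

lemma trivializes_coboundary: "trivializes k (coboundary3 k) (\<lambda>x y. k y x - k x y)"
  by (simp add: trivializes_def)

lemma normalizable:
  assumes "two_abelian_cocycle h c"
  obtains k where "normalized (h - coboundary3 k) (c - (\<lambda>x y. k y x - k x y))"
proof
  \<comment> \<open>The cocycle identity at \<open>(x, 0, 0, y)\<close> reads
    \<open>h x 0 y = h x 0 0 + h 0 0 y\<close>, and
    \<open>coboundary3 k x 0 y = k 0 y - k x 0\<close>. These values on the axes thus remove
    \<open>h x 0 y\<close>; they agree at the origin because \<open>h 0 0 0 = 0\<close>.\<close>
  define k where "k = (\<lambda>x y. if x = 0 then h 0 0 y else if y = 0 then - h x 0 0 else 0)"
  let ?h = "h - coboundary3 k" and ?c = "c - (\<lambda>x y. k y x - k x y)"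
  have zero: "h 0 0 0 = 0"
    using cocycle3_defect[OF two_abelian_cocycle_imp_cocycle3[OF assms], of 0 0 0 0] by simp
  have cocycle: "two_abelian_cocycle ?h ?c"
    by (rule two_abelian_cocycle_diff_coboundary[OF assms])
  note hc = cocycle3_defect[OF two_abelian_cocycle_imp_cocycle3[OF cocycle]]
  have middle: "?h x 0 y = 0" for x y
    using cocycle3_defect[OF two_abelian_cocycle_imp_cocycle3[OF assms], of x 0 0 y] zero
    by (auto simp: coboundary3_def k_def algebra_simps)
  have left: "?h 0 x y = 0" for x y
    using hc[of 0 0 x y] unfolding middle by simp
  have right: "?h x y 0 = 0" for x y
    using hc[of x y 0 0] unfolding middle by simp
  have "?c x 0 = 0" for x
    using hexagon1_defect[OF cocycle, of x 0 0] unfolding middle left right by simp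
  moreover have "?c 0 x = 0" for x
    using hexagon2_defect[OF cocycle, of 0 0 x] unfolding middle left right by simp
  ultimately show "normalized ?h ?c"
    unfolding normalized_def by (intro allI conjI left middle right)
qed

lemma int_antidifference:
  fixes f :: "int \<Rightarrow> 'm::ab_group_add"
  obtains F where "F 0 = 0" "\<And>m. F (m + 1) = F m + f m"
proof -
  let ?F = "\<lambda>m. if 0 \<le> m then sum f {0..<m} else - sum f {m..<0}"
  have "?F (m + 1) = ?F m + f m" for m
  proof (cases "0 \<le> m")
    case True
    then have "{0..<m + 1} = insert m {0..<m}" by auto
    with True show ?thesis by (simp add: add.commute)
  next
    case False
    then have "{m..<0} = insert m {m + 1..<0}" by auto
    with False show ?thesis by auto
  qed
  then show thesis by (intro that[of ?F]) simp_all
qed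

lemma additive_int_eq_0:
  assumes "additive f" "f (1::int) = 0"
  shows "f n = 0"
proof (induction n rule: int_induct[where k = 0])
  case base
  show ?case using assms(1) by (rule additive.zero)
next
  case (step1 i)
  then show ?case using assms by (simp add: additive.add)
next
  case (step2 i)
  then show ?case using assms by (simp add: additive.diff)
qed

lemma two_abelian_cocycle_zero_associator:
  assumes "two_abelian_cocycle (\<lambda>x y z. 0) c"
  shows "biadditive c"
  using hexagon1_defect[OF assms] hexagon2_defect[OF assms]
  by (simp add: biadditive_def algebra_simps)

lemma biadditive_iff_additive: "biadditive b \<longleftrightarrow> (\<forall>z. additive (\<lambda>x. b x z)) \<and> (\<forall>x. additive (b x))"
  by (auto simp: biadditive_def additive_def)

text \<open>A recursion in the first argument of \<open>k\<close> removes \<open>h 1 m n\<close>;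
  the cocycle identity then makes the associator independent of its first argument, hence zero. What
  remains of \<open>c\<close> is biadditive and determined by its value at \<open>(1, 1)\<close>.
  The condition \<open>k 0 0 = 0\<close> is for gluing, where absent generators must contribute
  nothing.\<close>

lemma int_trivializable:
  fixes h :: "int \<Rightarrow> int \<Rightarrow> int \<Rightarrow> 'm::ab_group_add"
  assumes cocycle: "two_abelian_cocycle h c" and "normalized h c" and c11: "c 1 1 = 0"
  obtains k where "trivializes k h c" "k 0 0 = 0"
proof -
  have "\<exists>F. F 0 = 0 \<and> (\<forall>m. F (m + 1) = F m + - h 1 m n)" for n
    by (metis int_antidifference[of "\<lambda>m. - h 1 m n"])
  then obtain \<kappa> where \<kappa>: "\<And>n. \<kappa> n 0 = 0 \<and> (\<forall>m. \<kappa> n (m + 1) = \<kappa> n m + - h 1 m n)"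
    by metis
  define k where "k = (\<lambda>m n. \<kappa> n m)"
  have k0: "k 0 n = 0" and k_Suc: "k (m + 1) n = k m n - h 1 m n" for m n
    using \<kappa> by (simp_all add: k_def)
  have k1: "k 1 n = 0" for n
    using k_Suc[of 0 n] k0 \<open>normalized h c\<close> by (simp add: normalized_def)
  let ?h = "h - coboundary3 k" and ?c = "c - (\<lambda>x y. k y x - k x y)"
  have cocycle': "two_abelian_cocycle ?h ?c"
    by (rule two_abelian_cocycle_diff_coboundary[OF cocycle])
  have h1: "?h 1 m n = 0" for m n
    using k_Suc[of m n] k1 by (simp add: coboundary3_def add.commute)
  have h_Suc: "?h (l + 1) m n = ?h l m n" for l m n
    using cocycle3_defect[OF two_abelian_cocycle_imp_cocycle3[OF cocycle'], of 1 l m n]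
    unfolding h1 by (simp add: add.commute)
  have "?h l m n = 0" for l m n
  proof (induction l rule: int_induct[where k = 0])
    case base
    show ?case
      using k0 \<open>normalized h c\<close> by (simp add: coboundary3_def normalized_def)
  next
    case (step1 i)
    then show ?case using h_Suc[of i m n] by simp
  next
    case (step2 i)
    then show ?case using h_Suc[of "i - 1" m n] by simp
  qed
  then have h0: "?h = (\<lambda>l m n. 0)" by (simp add: fun_eq_iff)
  have biadd: "biadditive ?c"
    using cocycle' unfolding h0 by (rule two_abelian_cocycle_zero_associator)
  have "?c 1 1 = 0" using c11 by simp
  moreover have "additive (?c 1)"
    using biadd by (simp only: biadditive_iff_additive)
  ultimately have c1: "?c 1 n = 0" for n
    by (rule additive_int_eq_0[rotated])
  have "additive (\<lambda>m. ?c m n)" for n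
    using biadd by (simp only: biadditive_iff_additive)
  then have "?c m n = 0" for m n
    using c1 by (rule additive_int_eq_0)
  then have "trivializes k h c"
    using h0 by (simp add: trivializes_def fun_eq_iff)
  with k0 that show thesis by blast
qed

subsection \<open>Free abelian groups\<close>

lemma additive_eqI:
  assumes "additive f" "additive g" "\<And>i. f (frag_of i) = g (frag_of i)"
  shows "f x = g x"
  using subset_UNIV
  by (induction x rule: frag_induction) (simp_all add: assms additive.zero additive.diff)

lemma additive_extension:
  fixes f :: "'i \<Rightarrow> 'm::ab_group_add"
  obtains \<phi> where "additive \<phi>" "\<And>i. \<phi> (frag_of i) = f i"
proof -
  let ?M = "\<lparr>carrier = UNIV, mult = (+), one = 0\<rparr> :: 'm monoid"
  have "comm_group ?M"
  proof (rule comm_groupI, goal_cases)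
    case (6 x)
    show ?case by (rule bexI[of _ "- x"]) simp_all
  qed (simp_all add: add_ac)
  then obtain \<phi> where "\<phi> \<in> hom (free_Abelian_group UNIV) ?M" "\<And>i. \<phi> (frag_of i) = f i"
    using comm_group.free_Abelian_group_universal[of ?M f UNIV] by auto
  then show thesis
    by (intro that[of \<phi>]) (simp_all add: additive_def hom_def)
qed

lemma biadditive_eqI:
  assumes "biadditive b" "biadditive b'" "\<And>i j. b (frag_of i) (frag_of j) = b' (frag_of i) (frag_of j)"
  shows "b x y = b' x y"
proof -
  have "b (frag_of i) y = b' (frag_of i) y" for i
    by (rule additive_eqI[of "b (frag_of i)" "b' (frag_of i)"])
      (use assms in \<open>auto simp: biadditive_iff_additive\<close>)
  then show ?thesis
    by (rule additive_eqI[of "\<lambda>x. b x y" "\<lambda>x. b' x y", rotated 2])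
      (use assms in \<open>auto simp: biadditive_iff_additive\<close>)
qed

lemma biadditive_extension:
  fixes f :: "'i \<Rightarrow> 'i \<Rightarrow> 'm::ab_group_add"
  obtains b where "biadditive b" "\<And>i j. b (frag_of i) (frag_of j) = f i j"
proof -
  have "\<exists>\<phi>. additive \<phi> \<and> (\<forall>j. \<phi> (frag_of j) = f i j)" for i
    by (metis additive_extension)
  then obtain \<phi> where \<phi>: "\<And>i. additive (\<phi> i)" "\<And>i j. \<phi> i (frag_of j) = f i j"
    by metis
  \<comment> \<open>The universal property is applied with values in the group of functions under
    pointwise addition.\<close>
  obtain b where b: "additive b" "\<And>i. b (frag_of i) = \<phi> i"
    using additive_extension[of \<phi>] by metis
  have "additive (b x)" for x
    using subset_UNIV
  proof (induction x rule: frag_induction)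
    case zero
    show ?case by (simp add: additive.zero[OF b(1)] additive_def)
  next
    case (one i)
    show ?case by (simp add: b \<phi>)
  next
    case (diff x y)
    then show ?case by (simp add: additive.diff[OF b(1)] additive_def)
  qed
  moreover have "additive (\<lambda>x. b x z)" for z
    using b(1) by (simp add: additive_def)
  ultimately show thesis
    using b \<phi> by (intro that[of b]) (simp_all add: biadditive_iff_additive)
qed

lemma symmetric_cocycle_free:
  fixes k :: "('i \<Rightarrow>\<^sub>0 int) \<Rightarrow> ('i \<Rightarrow>\<^sub>0 int) \<Rightarrow> 'm::ab_group_add"
  assumes cocycle: "coboundary3 k = 0" and sym: "\<And>x y. k x y = k y x"
  obtains u where "\<And>x y. k x y = u x + u y - u (x + y)"
proof -
  have k: "k y z + k x (y + z) = k (x + y) z + k x y" for x y z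
    using fun_cong[OF fun_cong[OF fun_cong[OF cocycle, of x], of y], of z]
    by (simp add: coboundary3_def algebra_simps)
  define e where "e = k 0 0"
  have k0: "k 0 x = e" for x
    using k[of 0 x 0] sym[of x 0] by (simp add: e_def)
  \<comment> \<open>\<open>E\<close> is the abelian extension of the free group classified by \<open>k\<close>; freeness splits it.\<close>
  define E :: "('m \<times> ('i \<Rightarrow>\<^sub>0 int)) monoid" where
    "E = \<lparr>carrier = UNIV, mult = (\<lambda>p q. (fst p + fst q + k (snd p) (snd q), snd p + snd q)),
      one = (- e, 0)\<rparr>"
  have "comm_group E"
  proof (rule comm_groupI, goal_cases)
    case (3 p q r)
    show ?case
      using k[of "snd q" "snd r" "snd p"] by (simp add: E_def algebra_simps)
  next
    case (4 p q)
    show ?case by (simp add: E_def sym[of "snd p"] add.commute)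
  next
    case (6 p)
    show ?case
      by (rule bexI[of _ "(- fst p - k (- snd p) (snd p) - e, - snd p)"]) (simp_all add: E_def)
  qed (simp_all add: E_def k0)
  moreover have "(\<lambda>i. (0, frag_of i)) ` UNIV \<subseteq> carrier E"
    by (simp add: E_def)
  ultimately obtain \<phi> where \<phi>: "\<phi> \<in> hom (free_Abelian_group UNIV) E"
      "\<And>i. \<phi> (frag_of i) = (0, frag_of i)"
    using comm_group.free_Abelian_group_universal[of E "\<lambda>i. (0, frag_of i)" UNIV]
    by (metis UNIV_I)
  have add: "\<phi> (x + y) = (fst (\<phi> x) + fst (\<phi> y) + k (snd (\<phi> x)) (snd (\<phi> y)), snd (\<phi> x) + snd (\<phi> y))" for x y
    using \<phi>(1) by (simp add: hom_def E_def)
  have "snd (\<phi> x) = x" for x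
    by (rule additive_eqI[of "\<lambda>x. snd (\<phi> x)" "\<lambda>x. x"]) (simp_all add: additive_def add \<phi>(2))
  with add show thesis
    by (intro that[of "\<lambda>x. - fst (\<phi> x)"]) simp
qed

text \<open>The generators form a bare type; in this form a well-order on them can be interpreted
  locally inside a proof.\<close>

lemma wellorder_exists:
  obtains le ls :: "'i \<Rightarrow> 'i \<Rightarrow> bool" where "class.wellorder le ls"
proof -
  obtain r :: "'i rel" where r: "Well_order r" "Field r = UNIV"
    using well_ordering by metis
  then have refl: "refl r" and trans: "trans r" and antisym: "antisym r"
    and total: "total r" and wf: "wf (r - Id)"
    by (auto simp: order_on_defs)
  have "class.wellorder (\<lambda>x y. (x, y) \<in> r) (\<lambda>x y. (x, y) \<in> r - Id)"
  proof (unfold_locales, goal_cases)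
    case (1 x y)
    then show ?case using antisym by (auto dest: antisymD)
  next
    case (2 x)
    then show ?case using refl by (auto dest: refl_onD)
  next
    case (3 x y z)
    then show ?case using trans by (rule_tac transD)
  next
    case (4 x y)
    then show ?case using antisym by (auto dest: antisymD)
  next
    case (5 x y)
    then show ?case using total refl by (cases "x = y") (auto simp: total_on_def dest: refl_onD)
  next
    case (6 P a)
    then show ?case using wf_induct_rule[OF wf, of P a] by blast
  qed
  then show thesis by (rule that)
qed

section \<open>Gluing trivializations over the generators of a free abelian group\<close>

definition restrict_frag :: "'i set \<Rightarrow> ('i \<Rightarrow>\<^sub>0 int) \<Rightarrow> ('i \<Rightarrow>\<^sub>0 int)" where
  "restrict_frag S = frag_extend (\<lambda>i. if i \<in> S then frag_of i else 0)"

lemma lookup_restrict_frag: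
  "Poly_Mapping.lookup (restrict_frag S x) i = (if i \<in> S then Poly_Mapping.lookup x i else 0)"
  using subset_UNIV
  by (induction x rule: frag_induction)
    (auto simp: restrict_frag_def frag_extend_diff lookup_minus)

lemma restrict_frag_add: "restrict_frag S (x + y) = restrict_frag S x + restrict_frag S y"
  by (simp add: restrict_frag_def frag_extend_add)

lemma restrict_frag_insert:
  "i \<notin> S \<Longrightarrow> restrict_frag (insert i S) x = restrict_frag S x + restrict_frag {i} x"
  by (rule poly_mapping_eqI) (simp add: lookup_restrict_frag lookup_add)

lemma restrict_frag_singleton: "restrict_frag {i} x = frag_cmul (Poly_Mapping.lookup x i) (frag_of i)"
  by (rule poly_mapping_eqI) (auto simp: lookup_restrict_frag)

lemma restrict_frag_cong:
  assumes "S \<inter> Poly_Mapping.keys x = T \<inter> Poly_Mapping.keys x"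
  shows "restrict_frag S x = restrict_frag T x"
proof (rule poly_mapping_eqI)
  fix i
  have "i \<in> S \<longleftrightarrow> i \<in> T" if "i \<in> Poly_Mapping.keys x"
    using assms that by blast
  then show "Poly_Mapping.lookup (restrict_frag S x) i = Poly_Mapping.lookup (restrict_frag T x) i"
    by (cases "i \<in> Poly_Mapping.keys x") (simp_all add: lookup_restrict_frag in_keys_iff)
qed

lemma restrict_frag_superset: "Poly_Mapping.keys x \<subseteq> S \<Longrightarrow> restrict_frag S x = x"
  by (rule poly_mapping_eqI) (auto simp: lookup_restrict_frag in_keys_iff)

lemma restrict_frag_empty [simp]: "restrict_frag {} x = 0"
  by (rule poly_mapping_eqI) (simp add: lookup_restrict_frag)

text \<open>Each new generator adds a cyclic summand: its own trivialization
  \<open>\<kappa> i\<close>, corrected by the interchange with the span of the earlier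
  generators.\<close>

primrec assemble ::
  "(('i \<Rightarrow>\<^sub>0 int) \<Rightarrow> ('i \<Rightarrow>\<^sub>0 int) \<Rightarrow> ('i \<Rightarrow>\<^sub>0 int) \<Rightarrow> 'm::ab_group_add) \<Rightarrow> (('i \<Rightarrow>\<^sub>0 int) \<Rightarrow> ('i \<Rightarrow>\<^sub>0 int) \<Rightarrow> 'm) \<Rightarrow>
   ('i \<Rightarrow> int \<Rightarrow> int \<Rightarrow> 'm) \<Rightarrow> 'i list \<Rightarrow> ('i \<Rightarrow>\<^sub>0 int) \<Rightarrow> ('i \<Rightarrow>\<^sub>0 int) \<Rightarrow> 'm" where
  "assemble h c \<kappa> [] x y = 0"
| "assemble h c \<kappa> (i # L) x y =
     assemble h c \<kappa> L x y + \<kappa> i (Poly_Mapping.lookup x i) (Poly_Mapping.lookup y i)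
     + interchange h c (restrict_frag (set L) x) (restrict_frag {i} x)
         (restrict_frag (set L) y) (restrict_frag {i} y)"

lemma assemble_trivializes:
  assumes cocycle: "two_abelian_cocycle h c" and "normalized h c"
    and antisym: "\<And>x y. c x y + c y x = 0"
    and \<kappa>: "\<And>i. trivializes (\<kappa> i)
      (\<lambda>l m n. h (frag_cmul l (frag_of i)) (frag_cmul m (frag_of i)) (frag_cmul n (frag_of i)))
      (\<lambda>m n. c (frag_cmul m (frag_of i)) (frag_cmul n (frag_of i)))"
    and "distinct L"
  shows "trivializes (assemble h c \<kappa> L)
    (\<lambda>x y z. h (restrict_frag (set L) x) (restrict_frag (set L) y) (restrict_frag (set L) z))
    (\<lambda>x y. c (restrict_frag (set L) x) (restrict_frag (set L) y))"
  using \<open>distinct L\<close>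
proof (induction L)
  case Nil
  show ?case
    using \<open>normalized h c\<close> by (simp add: trivializes_def coboundary3_def normalized_def fun_eq_iff)
next
  case (Cons i L)
  then have "i \<notin> set L" and "distinct L" by simp_all
  note split = restrict_frag_insert[OF \<open>i \<notin> set L\<close>]
  let ?K = "assemble h c \<kappa> L" and ?p = "restrict_frag (set L)" and ?e = "restrict_frag {i}"
    and ?l = "\<lambda>x. Poly_Mapping.lookup x i"
  have h_K: "h (?p x) (?p y) (?p z) = coboundary3 ?K x y z"
    and c_K: "c (?p x) (?p y) = ?K y x - ?K x y" for x y z
    using Cons.IH[OF \<open>distinct L\<close>] by (simp_all add: trivializes_def fun_eq_iff)
  have h_\<kappa>: "h (?e x) (?e y) (?e z) = coboundary3 (\<kappa> i) (?l x) (?l y) (?l z)"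
    and c_\<kappa>: "c (?e x) (?e y) = \<kappa> i (?l y) (?l x) - \<kappa> i (?l x) (?l y)" for x y z
    using \<kappa>[of i] by (simp_all add: trivializes_def fun_eq_iff restrict_frag_singleton)
  show ?case
    unfolding trivializes_def list.set fun_eq_iff split
  proof (intro conjI allI)
    show "h (?p x + ?e x) (?p y + ?e y) (?p z + ?e z) = coboundary3 (assemble h c \<kappa> (i # L)) x y z"
      for x y z
      unfolding interchange_associator[OF cocycle] h_K h_\<kappa>
      by (simp add: coboundary3_def restrict_frag_add lookup_add)
    show "c (?p x + ?e x) (?p y + ?e y) = assemble h c \<kappa> (i # L) y x - assemble h c \<kappa> (i # L) x y"
      for x y
      unfolding interchange_braiding[OF cocycle antisym] c_K c_\<kappa>
      by simp
  qed
qed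

text \<open>For a generator outside \<open>S\<close> both cyclic components are zero, so every term
  of the interchange has a zero argument and vanishes by normalization. For the others, the shorter
  list cuts out the same parts of \<open>x\<close> and \<open>y\<close>.\<close>

lemma assemble_filter:
  assumes "normalized h c" "\<And>i. \<kappa> i 0 0 = 0"
    and "Poly_Mapping.keys x \<union> Poly_Mapping.keys y \<subseteq> S"
  shows "assemble h c \<kappa> (filter (\<lambda>i. i \<in> S) L) x y = assemble h c \<kappa> L x y"
proof (induction L)
  case (Cons i L)
  show ?case
  proof (cases "i \<in> S")
    case True
    have "restrict_frag (set (filter (\<lambda>i. i \<in> S) L)) x = restrict_frag (set L) x"
      "restrict_frag (set (filter (\<lambda>i. i \<in> S) L)) y = restrict_frag (set L) y"
      using assms(3) by (auto intro!: restrict_frag_cong)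
    with True Cons.IH show ?thesis by simp
  next
    case False
    then have "Poly_Mapping.lookup x i = 0" "Poly_Mapping.lookup y i = 0"
      using assms(3) by (auto simp: in_keys_iff)
    with False Cons.IH assms(1,2) show ?thesis
      by (simp add: restrict_frag_singleton interchange_def normalized_def)
  qed
qed simp

lemma frag_trivializable:
  fixes h :: "('i \<Rightarrow>\<^sub>0 int) \<Rightarrow> ('i \<Rightarrow>\<^sub>0 int) \<Rightarrow> ('i \<Rightarrow>\<^sub>0 int) \<Rightarrow> 'm::ab_group_add"
  assumes cocycle: "two_abelian_cocycle h c" and norm: "normalized h c" and trace: "\<And>x. c x x = 0"
  obtains k where "trivializes k h c"
proof -
  have antisym: "c x y + c y x = 0" for x y
    using polar_trace[OF cocycle, of x y] trace by (simp add: polar_def)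
  have "\<exists>k. trivializes k
      (\<lambda>l m n. h (frag_cmul l (frag_of i)) (frag_cmul m (frag_of i)) (frag_cmul n (frag_of i)))
      (\<lambda>m n. c (frag_cmul m (frag_of i)) (frag_cmul n (frag_of i))) \<and> k 0 0 = 0" (is "\<exists>k. trivializes k ?h ?c \<and> _")
    for i
  proof -
    have "two_abelian_cocycle ?h ?c"
      unfolding two_abelian_cocycle_def cocycle3_def frag_cmul_distrib
      using cocycle by (simp only: two_abelian_cocycle_def cocycle3_def) blast
    moreover have "normalized ?h ?c"
      using norm by (simp add: normalized_def)
    ultimately show ?thesis
      using int_trivializable[of ?h ?c] trace by auto
  qed
  then obtain \<kappa> where \<kappa>: "\<And>i. trivializes (\<kappa> i)
      (\<lambda>l m n. h (frag_cmul l (frag_of i)) (frag_cmul m (frag_of i)) (frag_cmul n (frag_of i)))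
      (\<lambda>m n. c (frag_cmul m (frag_of i)) (frag_cmul n (frag_of i)))" "\<And>i. \<kappa> i 0 0 = 0"
    by metis
  obtain le ls :: "'i \<Rightarrow> 'i \<Rightarrow> bool" where "class.wellorder le ls"
    by (rule wellorder_exists)
  then interpret wellorder le ls .
  let ?enum = sorted_list_of_set
  \<comment> \<open>Generators outside the supports contribute nothing, so every finite set of generators that
    contains the supports gives the same value, as long as it is listed in the same order.\<close>
  define k where "k = (\<lambda>x y. assemble h c \<kappa> (?enum (Poly_Mapping.keys x \<union> Poly_Mapping.keys y)) x y)"
  have k: "k x y = assemble h c \<kappa> (?enum J) x y"
    if "finite J" "Poly_Mapping.keys x \<subseteq> J" "Poly_Mapping.keys y \<subseteq> J" for J x y
  proof -
    let ?S = "Poly_Mapping.keys x \<union> Poly_Mapping.keys y"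
    have "?enum ?S = filter (\<lambda>i. i \<in> ?S) (?enum J)"
      by (rule sorted_distinct_set_unique) (use that in \<open>auto simp: sorted_wrt_filter\<close>)
    then show ?thesis
      using assemble_filter[of h c \<kappa> x y ?S "?enum J"] norm \<kappa>(2) by (simp add: k_def)
  qed
  have "h x y z = coboundary3 k x y z \<and> c x y = k y x - k x y" for x y z
  proof -
    \<comment> \<open>The identities at \<open>x\<close>, \<open>y\<close>, \<open>z\<close>
      evaluate \<open>k\<close> only at elements supported in \<open>?J\<close>, so one finite list
      serves all their terms.\<close>
    let ?J = "Poly_Mapping.keys x \<union> Poly_Mapping.keys y \<union> Poly_Mapping.keys z"
    have "trivializes (assemble h c \<kappa> (?enum ?J))
      (\<lambda>x y z. h (restrict_frag ?J x) (restrict_frag ?J y) (restrict_frag ?J z))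
      (\<lambda>x y. c (restrict_frag ?J x) (restrict_frag ?J y))"
      using assemble_trivializes[OF cocycle norm antisym \<kappa>(1), of "?enum ?J"] by simp
    then have "h (restrict_frag ?J x) (restrict_frag ?J y) (restrict_frag ?J z)
        = coboundary3 (assemble h c \<kappa> (?enum ?J)) x y z"
      "c (restrict_frag ?J x) (restrict_frag ?J y)
        = assemble h c \<kappa> (?enum ?J) y x - assemble h c \<kappa> (?enum ?J) x y"
      by (simp_all add: trivializes_def fun_eq_iff)
    moreover have "restrict_frag ?J x = x" "restrict_frag ?J y = y" "restrict_frag ?J z = z"
      by (auto intro: restrict_frag_superset)
    moreover have "Poly_Mapping.keys (x + y) \<subseteq> ?J" "Poly_Mapping.keys (y + z) \<subseteq> ?J"
      using keys_add[of x y] keys_add[of y z] by auto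
    ultimately show ?thesis
      by (simp add: coboundary3_def k[of ?J] le_supI1)
  qed
  then show thesis
    by (intro that[of k]) (simp add: trivializes_def fun_eq_iff)
qed

section \<open>Subgroups of free abelian groups\<close>

lemma int_subgroup_generator:
  fixes A :: "int set"
  assumes zero: "0 \<in> A" and diff: "\<And>a b. a \<in> A \<Longrightarrow> b \<in> A \<Longrightarrow> a - b \<in> A"
  obtains d where "d \<in> A" "\<And>a. a \<in> A \<Longrightarrow> d dvd a"
proof (cases "A = {0}")
  case True
  then show thesis by (intro that[of 0]) simp_all
next
  case False
  have minus: "- a \<in> A" if "a \<in> A" for a
    using diff[OF zero that] by simp
  have add: "a + b \<in> A" if "a \<in> A" "b \<in> A" for a b
    using diff[OF that(1) minus[OF that(2)]] by simp
  have mult: "k * a \<in> A" if "a \<in> A" for a k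
    by (induction k rule: int_induct[where k = 0]) (auto simp: zero algebra_simps add diff that)
  obtain a where "a \<in> A" "a \<noteq> 0" using False zero by blast
  then have "\<exists>n>0. int n \<in> A"
    using minus[of a] by (intro exI[of _ "nat \<bar>a\<bar>"]) (auto simp: abs_if)
  then obtain n where n: "n > 0" "int n \<in> A" and least: "\<And>m. m > 0 \<Longrightarrow> int m \<in> A \<Longrightarrow> n \<le> m"
    using exists_least_iff[of "\<lambda>n. n > 0 \<and> int n \<in> A"] by (metis not_le)
  show thesis
  proof (rule that)
    show "int n \<in> A" by (rule n)
    fix a assume "a \<in> A"
    then have "a mod int n \<in> A"
      using diff[OF \<open>a \<in> A\<close> mult[OF n(2), of "a div int n"]] by (simp add: minus_div_mult_eq_mod)
    moreover have "0 \<le> a mod int n" "a mod int n < int n"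
      using n(1) by simp_all
    ultimately have "a mod int n = 0"
      using least[of "nat (a mod int n)"] by fastforce
    then show "int n dvd a" by (simp add: dvd_eq_mod_eq_0)
  qed
qed

text \<open>
  This is Dedekind's theorem that a subgroup \<open>R\<close> of a free abelian group is free, in the form
  that \<open>R\<close> is a retract of a free group. For each \<open>i\<close> of the well-ordered set of generators,
  \<open>r i\<close> has the least leading coefficient at \<open>i\<close>; the nonzero \<open>r i\<close> form a basis.
\<close>

lemma subgroup_of_free_projective:
  fixes R :: "('i \<Rightarrow>\<^sub>0 int) set"
  assumes zero: "0 \<in> R" and diff: "\<And>x y. x \<in> R \<Longrightarrow> y \<in> R \<Longrightarrow> x - y \<in> R"
  obtains P T :: "('i \<Rightarrow>\<^sub>0 int) \<Rightarrow> ('i \<Rightarrow>\<^sub>0 int)" where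
    "additive P" "\<And>x. P x \<in> R" "\<And>x y. x \<in> R \<Longrightarrow> y \<in> R \<Longrightarrow> T (x + y) = T x + T y"
    "\<And>x. x \<in> R \<Longrightarrow> P (T x) = x"
proof -
  obtain le ls :: "'i \<Rightarrow> 'i \<Rightarrow> bool" where "class.wellorder le ls"
    by (rule wellorder_exists)
  then interpret W: wellorder le ls .
  have top_key: "\<exists>i\<in>Poly_Mapping.keys x. \<forall>j\<in>Poly_Mapping.keys x. le j i" if "x \<noteq> 0" for x :: "'i \<Rightarrow>\<^sub>0 int"
    using W.finite_has_maximal[of "Poly_Mapping.keys x"] that
    by (metis W.linear finite_keys keys_eq_empty)
  define below where "below i = {x \<in> R. \<forall>j\<in>Poly_Mapping.keys x. le j i}" for i
  have below_diff: "x - y \<in> below i" if "x \<in> below i" "y \<in> below i" for x y i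
    using that keys_diff[of x y] diff by (auto simp: below_def)
  \<comment> \<open>The coefficients at \<open>i\<close> of elements of \<open>below i\<close> form
    a subgroup of the integers, and \<open>r\<close> realizes a generator; if that is zero,
    \<open>r = 0\<close> is chosen.\<close>
  have lead: "\<exists>r\<in>below i. (\<forall>x\<in>below i. Poly_Mapping.lookup r i dvd Poly_Mapping.lookup x i) \<and>
      (Poly_Mapping.lookup r i = 0 \<longrightarrow> r = 0)" for i
  proof -
    let ?A = "(\<lambda>x. Poly_Mapping.lookup x i) ` below i"
    have "0 \<in> below i" using zero by (simp add: below_def)
    then have "0 \<in> ?A" by (force intro: image_eqI[of _ _ 0])
    moreover have "a - b \<in> ?A" if "a \<in> ?A" "b \<in> ?A" for a b
      using that below_diff by (force simp flip: lookup_minus)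
    ultimately obtain d where d: "d \<in> ?A" "\<And>a. a \<in> ?A \<Longrightarrow> d dvd a"
      using int_subgroup_generator[of ?A] by blast
    show ?thesis
    proof (cases "d = 0")
      case True
      with d(2) \<open>0 \<in> below i\<close> show ?thesis by (intro bexI[of _ 0]) auto
    next
      case False
      with d show ?thesis by auto
    qed
  qed
  then obtain r where r: "\<And>i. r i \<in> below i"
      "\<And>i x. x \<in> below i \<Longrightarrow> Poly_Mapping.lookup (r i) i dvd Poly_Mapping.lookup x i"
      "\<And>i. Poly_Mapping.lookup (r i) i = 0 \<Longrightarrow> r i = 0"
    by metis
  define P where "P = frag_extend r"
  have P: "additive P" "P (x - y) = P x - P y" for x y
    by (simp_all add: P_def additive_def frag_extend_add frag_extend_diff)
  have P_R: "P x \<in> R" for x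
    using subset_UNIV
    by (induction x rule: frag_induction) (use zero diff r(1) in \<open>auto simp: P_def frag_extend_diff below_def\<close>)
  define J where "J = {i. Poly_Mapping.lookup (r i) i \<noteq> 0}"
  \<comment> \<open>Division algorithm: a multiple of \<open>r i\<close> cancels the coefficient at
    \<open>i\<close>, and the remainder is zero or has a smaller top generator.\<close>
  have surj_below: "\<exists>t. Poly_Mapping.keys t \<subseteq> J \<and> P t = x" if "x \<in> below i" for i x
    using that
  proof (induction i arbitrary: x rule: W.less_induct)
    case (less i)
    obtain m where m: "Poly_Mapping.lookup x i = m * Poly_Mapping.lookup (r i) i"
      using r(2)[OF less.prems] by (metis dvdE mult.commute)
    define s where "s = (if i \<in> J then frag_cmul m (frag_of i) else 0)"
    have P_s: "P s = frag_cmul m (r i)"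
      using r(3)[of i] by (auto simp: s_def P_def J_def frag_extend_cmul)
    have keys_s: "Poly_Mapping.keys s \<subseteq> J"
      by (auto simp: s_def)
    let ?y = "x - P s"
    have y_keys: "ls j i" if "j \<in> Poly_Mapping.keys ?y" for j
    proof -
      have "Poly_Mapping.lookup ?y i = 0"
        by (simp add: lookup_minus P_s m)
      then have "j \<noteq> i" using that by (auto simp: in_keys_iff)
      moreover have "le j i"
        using that keys_diff[of x "P s"] less.prems r(1)[of i] by (auto simp: below_def P_s)
      ultimately show ?thesis by (simp add: W.less_le)
    qed
    have "?y \<in> R"
      using less.prems P_R diff by (simp add: below_def)
    have "\<exists>t. Poly_Mapping.keys t \<subseteq> J \<and> P t = ?y"
    proof (cases "?y = 0")
      case True
      then show ?thesis by (intro exI[of _ 0]) (simp add: P_def)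
    next
      case False
      then obtain j where j: "j \<in> Poly_Mapping.keys ?y" "\<forall>j'\<in>Poly_Mapping.keys ?y. le j' j"
        using top_key by blast
      show ?thesis
        using less.IH[OF y_keys[OF j(1)]] j \<open>?y \<in> R\<close> by (simp add: below_def)
    qed
    then obtain t where t: "Poly_Mapping.keys t \<subseteq> J" "P t = ?y" by blast
    then have "P (t + s) = x"
      using additive.add[OF P(1)] by simp
    then show ?case
      using t(1) keys_s keys_add[of t s] by blast
  qed
  have surj: "\<exists>t. Poly_Mapping.keys t \<subseteq> J \<and> P t = x" if "x \<in> R" for x
  proof (cases "x = 0")
    case True
    then show ?thesis by (intro exI[of _ 0]) (simp add: P_def)
  next
    case False
    then obtain i where "\<forall>j\<in>Poly_Mapping.keys x. le j i"
      using top_key by blast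
    then show ?thesis
      using that by (intro surj_below[of x i]) (simp add: below_def)
  qed
  \<comment> \<open>Triangularity: at the top generator \<open>i\<close> of \<open>t\<close> only
    \<open>r i\<close> contributes to the coefficient of \<open>P t\<close>, and that coefficient of
    \<open>r i\<close> is nonzero on \<open>J\<close>.\<close>
  have ker: "t = 0" if "Poly_Mapping.keys t \<subseteq> J" "P t = 0" for t
  proof (rule ccontr)
    assume "t \<noteq> 0"
    then obtain i where i: "i \<in> Poly_Mapping.keys t" "\<And>j. j \<in> Poly_Mapping.keys t \<Longrightarrow> le j i"
      using top_key by blast
    have "Poly_Mapping.lookup t j * Poly_Mapping.lookup (r j) i = 0"
      if "j \<in> Poly_Mapping.keys t - {i}" for j
    proof -
      have "\<not> le i j"
        using that i(2)[of j] by (auto dest: W.order.antisym)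
      then have "i \<notin> Poly_Mapping.keys (r j)"
        using r(1)[of j] by (auto simp: below_def)
      then show ?thesis by (simp add: in_keys_iff)
    qed
    then have "(\<Sum>j\<in>Poly_Mapping.keys t - {i}. Poly_Mapping.lookup t j * Poly_Mapping.lookup (r j) i) = 0"
      by (meson sum.neutral)
    moreover have "Poly_Mapping.lookup (P t) i
        = (\<Sum>j\<in>Poly_Mapping.keys t. Poly_Mapping.lookup t j * Poly_Mapping.lookup (r j) i)"
      by (simp add: P_def frag_extend_def lookup_sum)
    ultimately have "Poly_Mapping.lookup (P t) i = Poly_Mapping.lookup t i * Poly_Mapping.lookup (r i) i"
      using sum.remove[OF finite_keys i(1), of "\<lambda>j. Poly_Mapping.lookup t j * Poly_Mapping.lookup (r j) i"]
      by linarith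
    moreover have "Poly_Mapping.lookup t i \<noteq> 0" "Poly_Mapping.lookup (r i) i \<noteq> 0"
      using that(1) i(1) unfolding J_def by auto
    ultimately show False
      using that(2) by simp
  qed
  \<comment> \<open>By \<open>ker\<close>, preimages supported in \<open>J\<close> are unique, which
    forces the choice \<open>T\<close> to be additive on \<open>R\<close>.\<close>
  obtain T where T: "\<And>x. x \<in> R \<Longrightarrow> Poly_Mapping.keys (T x) \<subseteq> J" "\<And>x. x \<in> R \<Longrightarrow> P (T x) = x"
    using surj by metis
  have T_add: "T (x + y) = T x + T y" if "x \<in> R" "y \<in> R" for x y
  proof -
    have "x + y \<in> R"
      using diff[OF that(1) diff[OF zero that(2)]] by simp
    then have "Poly_Mapping.keys (T (x + y) - (T x + T y)) \<subseteq> J"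
      using T(1)[of "x + y"] T(1)[OF that(1)] T(1)[OF that(2)]
        keys_diff[of "T (x + y)" "T x + T y"] keys_add[of "T x" "T y"] by blast
    moreover have "P (T (x + y) - (T x + T y)) = 0"
      by (simp only: P(2) additive.add[OF P(1)] T(2)[OF that(1)] T(2)[OF that(2)]
          T(2)[OF \<open>x + y \<in> R\<close>] diff_self)
    ultimately have "T (x + y) - (T x + T y) = 0"
      by (rule ker)
    then show ?thesis by simp
  qed
  from P(1) P_R T_add T(2) show thesis by (rule that)
qed

subsection \<open>Surjectivity of the trace\<close>

lemma quadratic_form_zero:
  assumes "quadratic_form q"
  shows "q 0 = 0"
proof -
  have "polar q 0 0 = 0"
    using assms by (metis quadratic_form_def biadditive_iff_additive additive.zero)
  then show ?thesis by (simp add: polar_def)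
qed

lemma polar_self:
  assumes "quadratic_form q"
  shows "polar q x x = q x + q x"
proof -
  have "polar q x (- x) = - polar q x x"
    using assms by (metis quadratic_form_def biadditive_iff_additive additive.minus)
  moreover have "q (- x) = q x" using assms by (simp add: quadratic_form_def)
  ultimately show ?thesis
    by (simp add: polar_def quadratic_form_zero[OF assms] algebra_simps)
qed

lemma polar_commute: "polar q x y = polar q y x"
  by (simp add: polar_def algebra_simps)

lemma quadratic_form_compose_additive:
  assumes "quadratic_form q" "additive f"
  shows "quadratic_form (\<lambda>x. q (f x))"
proof -
  have "polar (\<lambda>x. q (f x)) x y = polar q (f x) (f y)" for x y
    by (simp add: polar_def additive.add[OF assms(2)])
  with assms show ?thesis
    by (simp add: quadratic_form_def biadditive_def additive.add additive.minus)
qed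

text \<open>An upper triangular matrix with \<open>q\<close> on the diagonal and
  \<open>polar q\<close> above it has symmetrization \<open>polar q\<close>; hence
  \<open>q x - b x x\<close> is additive, and it vanishes on generators.\<close>

lemma quadratic_form_free:
  fixes q :: "('i \<Rightarrow>\<^sub>0 int) \<Rightarrow> 'm::ab_group_add"
  assumes "quadratic_form q"
  obtains b where "biadditive b" "\<And>x. b x x = q x"
proof -
  obtain le ls :: "'i \<Rightarrow> 'i \<Rightarrow> bool" where "class.wellorder le ls"
    by (rule wellorder_exists)
  then interpret W: wellorder le ls .
  obtain b where b: "biadditive b" "\<And>i j. b (frag_of i) (frag_of j)
      = (if ls i j then polar q (frag_of i) (frag_of j) else if i = j then q (frag_of i) else 0)"
    using biadditive_extension[of "\<lambda>i j.
      if ls i j then polar q (frag_of i) (frag_of j) else if i = j then q (frag_of i) else 0"] by blast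
  have polar: "b x y + b y x = polar q x y" for x y
  proof (rule biadditive_eqI[of "\<lambda>x y. b x y + b y x"])
    show "biadditive (\<lambda>x y. b x y + b y x)"
      using b(1) by (simp add: biadditive_def add_ac)
    show "biadditive (polar q)"
      using assms by (simp add: quadratic_form_def)
    show "b (frag_of i) (frag_of j) + b (frag_of j) (frag_of i) = polar q (frag_of i) (frag_of j)" for i j
      by (rule W.linorder_cases[of i j])
        (auto simp: b(2) polar_self[OF assms] polar_commute[of q "frag_of j"] dest: W.less_asym)
  qed
  have "additive (\<lambda>x. q x - b x x)"
  proof (unfold additive_def, intro allI)
    fix x y
    have "q (x + y) = q x + q y + (b x y + b y x)"
      by (simp add: polar polar_def)
    then show "q (x + y) - b (x + y) (x + y) = q x - b x x + (q y - b y y)"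
      using b(1) by (simp add: biadditive_def algebra_simps)
  qed
  moreover have "additive (\<lambda>x::'i \<Rightarrow>\<^sub>0 int. 0::'m)"
    by (simp add: additive_def)
  ultimately have "q x - b x x = 0" for x
    by (rule additive_eqI) (simp add: b(2))
  with b(1) show thesis by (intro that[of b]) simp_all
qed

text \<open>The strictly upper triangular part of the matrix of \<open>b\<close> serves as
  \<open>l\<close>.\<close>

lemma alternating_free:
  fixes b :: "('i \<Rightarrow>\<^sub>0 int) \<Rightarrow> ('i \<Rightarrow>\<^sub>0 int) \<Rightarrow> 'm::ab_group_add"
  assumes biadd: "biadditive b" and alt: "\<And>x. b x x = 0"
  obtains l where "biadditive l" "\<And>x y. b x y = l x y - l y x"
proof -
  obtain le ls :: "'i \<Rightarrow> 'i \<Rightarrow> bool" where "class.wellorder le ls"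
    by (rule wellorder_exists)
  then interpret W: wellorder le ls .
  obtain l where l: "biadditive l" "\<And>i j. l (frag_of i) (frag_of j)
      = (if ls i j then b (frag_of i) (frag_of j) else 0)"
    using biadditive_extension[of "\<lambda>i j. if ls i j then b (frag_of i) (frag_of j) else 0"] by blast
  have antisym: "b x y = - b y x" for x y
  proof -
    have "b (x + y) (x + y) = b x y + b y x"
      using biadd by (simp add: biadditive_def alt[of x] alt[of y])
    then show ?thesis by (simp add: alt eq_neg_iff_add_eq_0)
  qed
  have "b x y = l x y - l y x" for x y
  proof (rule biadditive_eqI[OF biadd])
    show "biadditive (\<lambda>x y. l x y - l y x)"
      using l(1) by (simp add: biadditive_def algebra_simps)
    show "b (frag_of i) (frag_of j) = l (frag_of i) (frag_of j) - l (frag_of j) (frag_of i)" for i j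
      by (rule W.linorder_cases[of i j])
        (auto simp: l(2) alt antisym[of "frag_of i" "frag_of j"] dest: W.less_asym)
  qed
  with l(1) show thesis by (rule that)
qed

lemma biadditive_diff:
  assumes "biadditive b"
  shows "b (x - y) z = b x z - b y z" "b x (y - z) = b x y - b x z"
  using assms
  by (simp_all add: biadditive_iff_additive additive.diff[of "b x"] additive.diff[of "\<lambda>x. b x z"])

text \<open>
  Steenrod's coboundary formula for the cup-1 product \<open>m\<close> of the 2-cocycle \<open>t\<close> with itself.
\<close>

lemma cup_1_coboundary:
  fixes l :: "'f::ab_group_add \<Rightarrow> 'f \<Rightarrow> 'm::ab_group_add" and t :: "'g::ab_group_add \<Rightarrow> 'g \<Rightarrow> 'f"
  assumes l: "biadditive l" and t: "\<And>x y z. t x y + t (x + y) z = t y z + t x (y + z)"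
  defines "m \<equiv> \<lambda>x y z. l (t (x + y) z) (t x y) - l (t x (y + z)) (t y z)"
  shows "m x y z + m x (y + z) w + m y z w - m (x + y) z w - m x y (z + w)
    = l (t z w) (t x y) - l (t x y) (t z w)"
proof -
  \<comment> \<open>The letters stand for the ten values of \<open>t\<close> that occur, with
    \<open>A = t x y\<close> and \<open>G = t z w\<close>; four instances of the cocycle identity
    eliminate \<open>B\<close>, \<open>F\<close>, \<open>H\<close> and \<open>J\<close>.\<close>
  have expand: "l B A - l E D + (l C E - l J F) + (l F D - l I G) - (l C B - l H G) - (l H A - l J I)
      = l G A - l A G"
    if "B = D + E - A" "F = G + I - D" "H = B + C - G" "J = E + C - F" for A B C D E F G H I J
    using l by (simp add: that biadditive_diff[OF l] biadditive_def algebra_simps)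
  have "t (x + y) z = t y z + t x (y + z) - t x y"
    using t[of x y z] by (simp add: algebra_simps)
  moreover have "t (y + z) w = t z w + t y (z + w) - t y z"
    using t[of y z w] by (simp add: algebra_simps)
  moreover have "t (x + y) (z + w) = t (x + y) z + t (x + y + z) w - t z w"
    using t[of "x + y" z w] by (simp add: algebra_simps)
  moreover have "t x (y + z + w) = t x (y + z) + t (x + y + z) w - t (y + z) w"
    using t[of x "y + z" w] by (simp add: algebra_simps)
  ultimately show ?thesis
    unfolding m_def add.assoc[symmetric] by (rule expand)
qed

lemma trace_surjective:
  fixes q :: "'g::ab_group_add \<Rightarrow> 'm::ab_group_add"
  assumes q: "quadratic_form q"
  obtains h c where "two_abelian_cocycle h c" "\<And>x. c x x = q x"
proof -
  obtain \<pi> :: "('g \<Rightarrow>\<^sub>0 int) \<Rightarrow> 'g" where \<pi>: "additive \<pi>" "\<And>g. \<pi> (frag_of g) = g"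
    using additive_extension[of "\<lambda>g. g"] by metis
  define R where "R = {r. \<pi> r = 0}"
  have R: "0 \<in> R" "\<And>x y. x \<in> R \<Longrightarrow> y \<in> R \<Longrightarrow> x - y \<in> R"
    by (simp_all add: R_def additive.zero[OF \<pi>(1)] additive.diff[OF \<pi>(1)])
  obtain P T :: "('g \<Rightarrow>\<^sub>0 int) \<Rightarrow> ('g \<Rightarrow>\<^sub>0 int)" where P: "additive P" "\<And>x. P x \<in> R"
    and T: "\<And>x y. x \<in> R \<Longrightarrow> y \<in> R \<Longrightarrow> T (x + y) = T x + T y" "\<And>x. x \<in> R \<Longrightarrow> P (T x) = x"
    using subgroup_of_free_projective[of R] R by metis
  obtain b where b: "biadditive b" "\<And>x. b x x = q (\<pi> x)"
    using quadratic_form_free[OF quadratic_form_compose_additive[OF q \<pi>(1)]] by metis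
  \<comment> \<open>The left side is the polar form of \<open>q\<close> at \<open>\<pi> x\<close>
    and \<open>\<pi> r = 0\<close>.\<close>
  have radical: "b x r + b r x = 0" if "r \<in> R" for x r
  proof -
    have "b (x + r) (x + r) = b x x + b r r"
      using that by (simp add: b(2) R_def additive.add[OF \<pi>(1)] quadratic_form_zero[OF q])
    then show ?thesis
      using b(1) by (simp add: biadditive_def algebra_simps)
  qed
  \<comment> \<open>Pulling back along \<open>P\<close> moves the form on \<open>R\<close> to a free
    group; elements of \<open>R\<close> enter \<open>l\<close> through their coordinates
    \<open>T\<close>.\<close>
  have "biadditive (\<lambda>x y. b (P x) (P y))"
    using b(1) by (simp add: biadditive_def additive.add[OF P(1)])
  moreover have "b (P x) (P x) = 0" for x
    using P(2)[of x] by (simp add: b(2) R_def quadratic_form_zero[OF q])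
  ultimately obtain l where l: "biadditive l" "\<And>x y. b (P x) (P y) = l x y - l y x"
    using alternating_free[of "\<lambda>x y. b (P x) (P y)"] by metis
  let ?s = "frag_of :: 'g \<Rightarrow> 'g \<Rightarrow>\<^sub>0 int"
  define \<rho> where "\<rho> x y = ?s x + ?s y - ?s (x + y)" for x y
  define t where "t x y = T (\<rho> x y)" for x y
  have \<rho>: "\<rho> x y \<in> R" for x y
    by (simp add: \<rho>_def R_def additive.add[OF \<pi>(1)] additive.diff[OF \<pi>(1)] \<pi>(2))
  have t: "t x y + t (x + y) z = t y z + t x (y + z)" for x y z
  proof -
    have "\<rho> x y + \<rho> (x + y) z = \<rho> y z + \<rho> x (y + z)"
      by (simp add: \<rho>_def algebra_simps)
    then show ?thesis
      by (simp add: t_def \<rho> flip: T(1))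
  qed
  have commute: "\<rho> x y = \<rho> y x" "t x y = t y x" for x y
    by (simp_all add: t_def \<rho>_def add.commute)
  have b_\<rho>: "b (\<rho> x y) (\<rho> z w) = l (t x y) (t z w) - l (t z w) (t x y)" for x y z w
    by (simp add: t_def T(2) \<rho> flip: l(2))
  \<comment> \<open>The coboundary of \<open>b (?s x) (\<rho> y z)\<close> is \<open>b (\<rho> x y) (\<rho> z w)\<close>; since \<open>b\<close> is the
    antisymmetrization of \<open>l\<close> on \<open>R\<close>, the cup-1 product \<open>m\<close> cancels it.\<close>
  define m where "m x y z = l (t (x + y) z) (t x y) - l (t x (y + z)) (t y z)" for x y z
  define h where "h x y z = b (?s x) (\<rho> y z) + m x y z" for x y z
  define c where "c x y = b (?s x) (?s y)" for x y
  \<comment> \<open>Since \<open>t\<close> is symmetric, the six terms cancel in pairs, so the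
    hexagons see only the \<open>b\<close> part of \<open>h\<close>.\<close>
  have m_shuffle: "m y z x + m x y z - m y x z = 0" for x y z
    by (simp add: m_def commute(2)[of "y + z" x] commute(2)[of z x] commute(2)[of y x] add.commute)
  have shuffle: "h y z x + h x y z - h y x z = b (?s x) (\<rho> y z)" for x y z
  proof -
    have "h y z x + h x y z - h y x z = b (?s x) (\<rho> y z) + (m y z x + m x y z - m y x z)"
      by (simp add: h_def commute(1)[of z x])
    then show ?thesis by (simp add: m_shuffle)
  qed
  have "two_abelian_cocycle h c"
    unfolding two_abelian_cocycle_def cocycle3_def
  proof (intro conjI allI)
    fix x y z w
    have \<delta>m: "m x y z + m x (y + z) w + m y z w - m (x + y) z w - m x y (z + w)
        = - b (\<rho> x y) (\<rho> z w)"
      using cup_1_coboundary[OF l(1) t, of x y z w] by (simp add: m_def b_\<rho>)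
    have "b (?s x) (\<rho> y z) + b (?s x) (\<rho> (y + z) w) + b (?s y) (\<rho> z w)
        - b (?s (x + y)) (\<rho> z w) - b (?s x) (\<rho> y (z + w)) = b (\<rho> x y) (\<rho> z w)"
      using b(1) by (simp add: \<rho>_def biadditive_diff[OF b(1)] biadditive_def algebra_simps)
    with \<delta>m have "(h x y z + h x (y + z) w + h y z w) - (h (x + y) z w + h x y (z + w)) = 0"
      by (simp add: h_def algebra_simps)
    then show "h x y z + h x (y + z) w + h y z w = h (x + y) z w + h x y (z + w)"
      by simp
  next
    fix x y z
    show "h y z x + c x (y + z) + h x y z = c x z + h y x z + c x y"
    proof -
      have "b (?s x) (\<rho> y z) = c x y + c x z - c x (y + z)"
        using b(1) by (simp add: c_def \<rho>_def biadditive_diff[OF b(1)] biadditive_def)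
      with shuffle[of y z x] have "h y z x + h x y z - h y x z = c x y + c x z - c x (y + z)"
        by (rule trans)
      then show ?thesis
        by (simp add: algebra_simps)
    qed
    show "- h z x y + c (x + y) z - h x y z = c x z - h x z y + c y z"
    proof -
      have "c x z + c y z - c (x + y) z = b (\<rho> x y) (?s z)"
        using b(1) by (simp add: c_def \<rho>_def biadditive_diff[OF b(1)] biadditive_def)
      \<comment> \<open>Hexagon 2 puts the defect in the first argument; \<open>radical\<close>
        moves it to the second at the cost of a sign.\<close>
      also have "\<dots> = - b (?s z) (\<rho> x y)"
        using radical[OF \<rho>, of "?s z" x y] by (simp add: eq_neg_iff_add_eq_0 add.commute)
      finally show ?thesis
        using shuffle[of x y z] by (simp add: algebra_simps)
    qed
  qed
  then show thesis
    by (rule that) (simp add: c_def b(2) \<pi>(2))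
qed

subsection \<open>Injectivity of the trace\<close>

text \<open>The coboundary of a 1-cochain is killed by \<open>coboundary3\<close>, and it is
  symmetric, so the braiding does not see it either.\<close>

lemma trivializes_subtract_symmetric_coboundary:
  assumes "trivializes k h c"
  shows "trivializes (\<lambda>x y. k x y - (v x + v y - v (x + y))) h c"
  using assms by (simp add: trivializes_def coboundary3_def fun_eq_iff algebra_simps)

lemma trivializable:
  fixes h :: "'g::ab_group_add \<Rightarrow> 'g \<Rightarrow> 'g \<Rightarrow> 'm::ab_group_add"
  assumes cocycle: "two_abelian_cocycle h c" and norm: "normalized h c" and trace: "\<And>x. c x x = 0"
  obtains k where "trivializes k h c"
proof -
  obtain \<pi> :: "('g \<Rightarrow>\<^sub>0 int) \<Rightarrow> 'g" where \<pi>: "additive \<pi>" "\<And>g. \<pi> (frag_of g) = g"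
    using additive_extension[of "\<lambda>g. g"] by metis
  note \<pi>_add = additive.add[OF \<pi>(1)] and \<pi>_diff = additive.diff[OF \<pi>(1)] and \<pi>_0 = additive.zero[OF \<pi>(1)]
  define R where "R = {r. \<pi> r = 0}"
  have R: "0 \<in> R" "\<And>x y. x \<in> R \<Longrightarrow> y \<in> R \<Longrightarrow> x - y \<in> R"
    by (simp_all add: R_def additive.zero[OF \<pi>(1)] additive.diff[OF \<pi>(1)])
  obtain P T :: "('g \<Rightarrow>\<^sub>0 int) \<Rightarrow> ('g \<Rightarrow>\<^sub>0 int)" where P: "additive P" "\<And>x. P x \<in> R"
    and T: "\<And>x y. x \<in> R \<Longrightarrow> y \<in> R \<Longrightarrow> T (x + y) = T x + T y" "\<And>x. x \<in> R \<Longrightarrow> P (T x) = x"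
    using subgroup_of_free_projective[of R] R by metis
  define h' where "h' x y z = h (\<pi> x) (\<pi> y) (\<pi> z)" for x y z
  define c' where "c' x y = c (\<pi> x) (\<pi> y)" for x y
  have "two_abelian_cocycle h' c'"
    unfolding two_abelian_cocycle_def cocycle3_def h'_def c'_def \<pi>_add
    using cocycle by (simp only: two_abelian_cocycle_def cocycle3_def) blast
  moreover have "normalized h' c'"
    using norm by (simp add: normalized_def h'_def c'_def \<pi>_0)
  moreover have "c' x x = 0" for x
    by (simp add: c'_def trace)
  ultimately obtain k0 where k0: "trivializes k0 h' c'"
    by (rule frag_trivializable)
  \<comment> \<open>By normalization \<open>h'\<close> and \<open>c'\<close> vanish on
    \<open>R\<close>, where \<open>\<pi>\<close> is zero; composition with \<open>P\<close> makes
    \<open>k0\<close> a symmetric cocycle on a free group.\<close>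
  have "coboundary3 (\<lambda>x y. k0 (P x) (P y)) = 0"
  proof -
    have "coboundary3 k0 (P x) (P y) (P z) = 0" for x y z
    proof -
      have "h' (P x) (P y) (P z) = coboundary3 k0 (P x) (P y) (P z)"
        using k0 by (simp add: trivializes_def)
      then show ?thesis
        using norm P(2)[of x] by (simp add: h'_def R_def normalized_def)
    qed
    then show ?thesis
      by (simp add: coboundary3_def fun_eq_iff additive.add[OF P(1)])
  qed
  moreover have "k0 (P x) (P y) = k0 (P y) (P x)" for x y
  proof -
    have "c' (P y) (P x) = k0 (P x) (P y) - k0 (P y) (P x)"
      using k0 by (simp add: trivializes_def)
    then show ?thesis
      using P(2)[of x] norm by (simp add: c'_def R_def normalized_def)
  qed
  ultimately obtain u where u: "\<And>x y. k0 (P x) (P y) = u x + u y - u (x + y)"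
    using symmetric_cocycle_free[of "\<lambda>x y. k0 (P x) (P y)"] by metis
  \<comment> \<open>Subtracting coboundaries of 1-cochains makes the trivialization vanish first on \<open>R \<times> R\<close> (\<open>k1\<close>)
    and then on all pairs with an entry in \<open>R\<close> (\<open>k2\<close>), whence it descends to the quotient.\<close>
  define k1 where "k1 x y = k0 x y - (u (T x) + u (T y) - u (T (x + y)))" for x y
  have k1: "trivializes k1 h' c'"
    using trivializes_subtract_symmetric_coboundary[OF k0, of "\<lambda>x. u (T x)"] by (simp add: k1_def[abs_def])
  have k1_R: "k1 x y = 0" if "x \<in> R" "y \<in> R" for x y
    using u[of "T x" "T y"] that by (simp add: k1_def T)
  have k1_0: "k1 x 0 = 0" for x
  proof -
    have "h' x 0 0 = k1 0 0 - k1 x 0"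
      using k1 by (simp add: trivializes_def coboundary3_def)
    then show ?thesis
      using norm k1_R[OF R(1) R(1)] by (simp add: h'_def \<pi>_0 normalized_def)
  qed
  \<comment> \<open>The value \<open>s 0 = 0\<close> makes the correction \<open>w\<close> vanish on
    \<open>R\<close>, so that \<open>k2\<close> still vanishes on
    \<open>R \<times> R\<close>.\<close>
  define s where "s g = (if g = 0 then 0 else frag_of g)" for g :: 'g
  have \<pi>_s: "\<pi> (s g) = g" for g
    by (simp add: s_def \<pi>(2) \<pi>_0)
  have decompose: "x - s (\<pi> x) \<in> R" for x
    by (simp add: R_def \<pi>_diff \<pi>_s)
  \<comment> \<open>For \<open>r\<close> in \<open>R\<close> this gives
    \<open>w (s g + r) = - k1 (s g) r\<close>, which cancels \<open>k1 (s g) r\<close> in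
    \<open>k2 (s g) r\<close>.\<close>
  define w where "w x = - k1 (s (\<pi> x)) (x - s (\<pi> x))" for x
  define k2 where "k2 x y = k1 x y - (w x + w y - w (x + y))" for x y
  have k2: "trivializes k2 h' c'"
    using trivializes_subtract_symmetric_coboundary[OF k1, of w] by (simp add: k2_def[abs_def])
  have h': "h' x y z = k2 y z - k2 (x + y) z + k2 x (y + z) - k2 x y"
    and c': "c' x y = k2 y x - k2 x y" for x y z
    using k2 by (simp_all add: trivializes_def coboundary3_def)
  have w_R: "w r = 0" if "r \<in> R" for r
    using that k1_R[OF R(1) that] by (simp add: w_def R_def s_def)
  have add_R: "x + y \<in> R" if "x \<in> R" "y \<in> R" for x y
    using that by (simp add: R_def \<pi>_add)
  have k2_R: "k2 x y = 0" if "x \<in> R" "y \<in> R" for x y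
    using that by (simp add: k2_def w_R add_R k1_R)
  have k2_s: "k2 (s g) r = 0" if "r \<in> R" for g r
    using that by (simp add: k2_def w_R) (simp add: w_def \<pi>_add \<pi>_s R_def k1_0)
  \<comment> \<open>With \<open>x = ?s + ?r\<close>, the identity \<open>h' ?s ?r r = 0\<close>
    expresses \<open>k2 x r\<close> through values already known to vanish.\<close>
  have right: "k2 x r = 0" if "r \<in> R" for x r
  proof -
    let ?s = "s (\<pi> x)" and ?r = "x - s (\<pi> x)"
    have "h' ?s ?r r = 0"
      using norm that by (simp add: h'_def R_def normalized_def)
    then show ?thesis
      using k2_R[OF decompose that] k2_s[OF decompose] k2_s[OF add_R[OF decompose that]]
      by (simp add: h')
  qed
  have left: "k2 r x = 0" if "r \<in> R" for x r
  proof -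
    have "c' x r = 0"
      using that norm by (simp add: c'_def R_def normalized_def)
    then show ?thesis by (simp add: c' right[OF that])
  qed
  have right_invariant: "k2 x (y + r) = k2 x y" if "r \<in> R" for x y r
  proof -
    have "h' x y r = 0"
      using that norm by (simp add: h'_def R_def normalized_def)
    then show ?thesis by (simp add: h' right[OF that])
  qed
  have left_invariant: "k2 (r + x) y = k2 x y" if "r \<in> R" for x y r
  proof -
    have "h' r x y = 0"
      using that norm by (simp add: h'_def R_def normalized_def)
    then show ?thesis by (simp add: h' left[OF that])
  qed
  define k where "k a b = k2 (s a) (s b)" for a b
  have k: "k (\<pi> x) (\<pi> y) = k2 x y" for x y
    using right_invariant[OF decompose, of x "s (\<pi> y)" y] left_invariant[OF decompose, of x "s (\<pi> x)"]
    by (simp add: k_def)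
  have "h x y z = coboundary3 k x y z" for x y z
    using h'[of "s x" "s y" "s z"] by (simp add: coboundary3_def h'_def \<pi>_add \<pi>_s flip: k)
  moreover have "c x y = k y x - k x y" for x y
    using c'[of "s x" "s y"] by (simp add: c'_def \<pi>_s flip: k)
  ultimately show thesis
    by (intro that[of k]) (simp add: trivializes_def fun_eq_iff)
qed

lemma trace_injective:
  assumes "two_abelian_cocycle h c" "\<And>x. c x x = 0"
  obtains k where "trivializes k h c"
proof -
  obtain l where l: "normalized (h - coboundary3 l) (c - (\<lambda>x y. l y x - l x y))"
    by (rule normalizable[OF assms(1)])
  obtain k where "trivializes k (h - coboundary3 l) (c - (\<lambda>x y. l y x - l x y))"
    by (rule trivializable[OF two_abelian_cocycle_diff_coboundary[OF assms(1)] l]) (simp add: assms(2))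
  from trivializes_add[OF this trivializes_coboundary[of l]] show thesis
    by (intro that[of "k + l"]) simp
qed

section \<open>The trace on cohomology classes\<close>

theorem theorem4p4:
  "(\<forall>(h, c) \<in> carrier (Z3_2ab :: ('g::ab_group_add, 'm::ab_group_add) two_ab_cochain monoid).
      \<forall>x. trace_map (B3_2ab #>\<^bsub>Z3_2ab\<^esub> (h, c)) x = c x x) \<and>
   trace_map \<in> iso (H3_2ab :: ('g, 'm) two_ab_cochain set monoid) (Quad :: ('g \<Rightarrow> 'm) monoid)"
proof
  show "\<forall>(h, c) \<in> carrier (Z3_2ab :: ('g, 'm) two_ab_cochain monoid).
      \<forall>x. trace_map (B3_2ab #>\<^bsub>Z3_2ab\<^esub> (h, c)) x = c x x"
    by (simp add: trace_map_class)
  let ?Z = "Z3_2ab :: ('g, 'm) two_ab_cochain monoid" and ?B = "B3_2ab :: ('g, 'm) two_ab_cochain set"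
    and ?H = "H3_2ab :: ('g, 'm) two_ab_cochain set monoid" and ?Q = "Quad :: ('g \<Rightarrow> 'm) monoid"
  interpret Z: comm_group ?Z by (rule comm_group_Z3_2ab)
  interpret H: comm_group ?H by (rule comm_group_H3_2ab)
  interpret Q: comm_group ?Q by (rule comm_group_Quad)
  interpret B: normal ?B ?Z
    by (rule Z.subgroup_imp_normal[OF subgroup_B3_2ab])
  have carrier_H: "\<exists>h c. two_abelian_cocycle h c \<and> C = ?B #>\<^bsub>?Z\<^esub> (h, c)" if "C \<in> carrier ?H" for C
    using that by (auto simp: H3_2ab_def FactGroup_def RCOSETS_def Z3_2ab_def)
  have class_in_H: "?B #>\<^bsub>?Z\<^esub> (h, c) \<in> carrier ?H" if "two_abelian_cocycle h c" for h c
    using that by (auto simp: H3_2ab_def FactGroup_def RCOSETS_def Z3_2ab_def)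
  have hom: "trace_map \<in> hom ?H ?Q"
  proof (rule homI)
    fix C assume "C \<in> carrier ?H"
    then obtain h c where "two_abelian_cocycle h c" "C = ?B #>\<^bsub>?Z\<^esub> (h, c)"
      using carrier_H by blast
    then show "trace_map C \<in> carrier ?Q"
      by (simp add: trace_map_class Quad_def quadratic_form_trace)
  next
    fix C D assume "C \<in> carrier ?H" "D \<in> carrier ?H"
    then obtain h c h' c' where C: "two_abelian_cocycle h c" "C = ?B #>\<^bsub>?Z\<^esub> (h, c)"
      and D: "two_abelian_cocycle h' c'" "D = ?B #>\<^bsub>?Z\<^esub> (h', c')"
      using carrier_H by meson
    have "C \<otimes>\<^bsub>?H\<^esub> D = ?B #>\<^bsub>?Z\<^esub> ((h, c) \<otimes>\<^bsub>?Z\<^esub> (h', c'))"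
      using B.rcos_sum[of "(h, c)" "(h', c')"] C D by (simp add: H3_2ab_def FactGroup_def Z3_2ab_def)
    also have "(h, c) \<otimes>\<^bsub>?Z\<^esub> (h', c') = (h + h', c + c')"
      by (simp add: Z3_2ab_def)
    finally show "trace_map (C \<otimes>\<^bsub>?H\<^esub> D) = trace_map C \<otimes>\<^bsub>?Q\<^esub> trace_map D"
      by (simp add: C D trace_map_class Quad_def fun_eq_iff)
  qed
  interpret tr: group_hom ?H ?Q trace_map
    using hom by unfold_locales
  show "trace_map \<in> iso ?H ?Q"
    unfolding tr.iso_iff
  proof (intro conjI ballI impI subsetI)
    fix q assume "q \<in> carrier ?Q"
    then obtain h c where "two_abelian_cocycle h c" "\<And>x. c x x = q x"
      using trace_surjective[of q] by (auto simp: Quad_def)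
    then show "q \<in> trace_map ` carrier ?H"
      by (intro image_eqI[OF _ class_in_H]) (simp_all add: trace_map_class fun_eq_iff)
  next
    fix C assume "C \<in> carrier ?H" and one: "trace_map C = \<one>\<^bsub>?Q\<^esub>"
    then obtain h c where C: "two_abelian_cocycle h c" "C = ?B #>\<^bsub>?Z\<^esub> (h, c)"
      using carrier_H by blast
    with one have "c x x = 0" for x
      by (simp add: trace_map_class Quad_def fun_eq_iff)
    then obtain k where "trivializes k h c"
      using trace_injective[OF C(1)] by blast
    then have "(h, c) \<in> ?B"
      by (auto simp: trivializes_def B3_2ab_def)
    then show "C = \<one>\<^bsub>?H\<^esub>"
      using B.rcos_const by (simp add: C(2) H3_2ab_def FactGroup_def)
  qed
qed

end
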